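(* (Intermediate Value Theorem) If $f$ is a continuous function on $[a,b] \subset \mathbf{No}$ with values in $\mathbf{No}$, then for every $u \in \mathbf{No}$ that lies between $f(a)$ and $f(b)$, there exists a number $p \in [a,b]$ such that $f(p) = u$.
   Context: $\mathbf{No}$ is the class of surreal numbers; $\mathbf{On}$ and $\mathbf{Off}$ also denote the gaps respectively larger than and smaller than all surreal numbers. Open subclasses of $\mathbf{No}$: the empty set is open; a nonempty subinterval of $\mathbf{No}$ is open if it has endpoints in $\mathbf{No}\cup\{\mathbf{On},\mathbf{Off}\}$ and does not contain its endpoints; a subclass $A\subset\mathbf{No}$ is open if $A=\bigcup_{i\in I}A_i$ where $I$ is a set (not a proper class) and the $A_i$ are open intervals. For $X\subset\mathbf{No}$, $X'\subset X$ is open in $X$ if $X'=X\cap X''$ for some open $X''\subset\mathbf{No}$. A function $f:A\to\mathbf{No}$ with $A\subset\mathbf{No}$ is continuous on $A$ if for every class $B$ open in $\mathbf{No}$, $f^{-1}(B)$ is open in $A$. *)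

theory Defs
  imports "HOL-Library.Multiset" "HOL-Library.Infinite_Typeclass"
begin

unbundle cardinal_syntax

section \<open>The background class theory\<close>

text \<open>
  Surreal numbers form a proper class, and HOL has no types of that size.  As in von Neumann's
  limitation of size, a type \<open>'u\<close> plays the role of the class of all sets: arbitrary HOL sets are
  classes, and a subclass of \<open>'u\<close> is a set iff it is strictly smaller than \<open>'u\<close>.
  The class axioms give infinity (there is an infinite set), and replacement and union (a union of
  set-many sets is a set).  Power sets are not needed; for \<open>'u\<close> of inaccessible cardinality one has
  exactly class theory with No a proper class, so theorems about an arbitrary
  \<open>'u :: universe\<close> include that case.
\<close>

class universe =
  assumes universe_infinity: "|UNIV :: nat set| <o |UNIV :: 'a set|"
    and universe_regular: "regularCard |UNIV :: 'a set|"

text \<open>The class axioms are satisfiable: above every infinite type there is a universe.\<close>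

instance suc :: (infinite) universe
proof
  let ?r = "|UNIV :: 'a set|"
  have co: "card_order ?r" by (rule card_of_card_order_on)
  have inf: "Cinfinite ?r"
    by (simp add: cinfinite_def infinite_UNIV Field_card_of card_of_card_order_on)
  have "card_order (card_suc ?r)" using co by (rule card_order_card_suc)
  then have iso: "card_suc ?r =o |UNIV :: 'a suc set|"
    using card_of_unique ordIso_symmetric by blast
  have "|UNIV :: nat set| \<le>o ?r"
    using infinite_UNIV infinite_iff_card_of_nat by blast
  then show "|UNIV :: nat set| <o |UNIV :: 'a suc set|"
    using card_suc_greater[OF co] iso
    by (meson ordLeq_ordLess_trans ordLess_ordIso_trans)
  show "regularCard |UNIV :: 'a suc set|"
    using regularCard_card_suc[OF co inf] iso Cinfinite_card_suc[OF inf co]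
      regularCard_ordIso by blast
qed

definition is_small :: "'u set \<Rightarrow> bool" where
  "is_small I \<longleftrightarrow> |I| <o |UNIV :: 'u set|"

lemma is_small_empty: "is_small ({} :: 'u set)"
  unfolding is_small_def
  by (metis card_of_empty3 card_of_Well_order empty_not_UNIV not_ordLeq_iff_ordLess)


section \<open>Surreal numbers\<close>

text \<open>
  Pairs \<open>{L | R}\<close>; the families \<open>L\<close> and \<open>R\<close> are indexed by the domains of partial maps on \<open>'u\<close>.
\<close>

datatype 'u game = Game "'u \<Rightarrow> 'u game option" "'u \<Rightarrow> 'u game option"

primrec left_opts :: "'u game \<Rightarrow> 'u game set" where
  "left_opts (Game l r) = ran l"

primrec right_opts :: "'u game \<Rightarrow> 'u game set" where
  "right_opts (Game l r) = ran r"

definition opt_rel :: "('u game \<times> 'u game) set" where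
  "opt_rel = {(z, x). z \<in> left_opts x \<or> z \<in> right_opts x}"

lemma wf_opt_rel: "wf opt_rel"
proof (rule wfUNIVI)
  fix P :: "'a game \<Rightarrow> bool" and x
  assume *: "\<forall>x. (\<forall>y. (y, x) \<in> opt_rel \<longrightarrow> P y) \<longrightarrow> P x"
  show "P x"
  proof (induction x)
    case (Game l r)
    show ?case
      by (rule *[rule_format])
        (auto simp: opt_rel_def ran_def intro: Game.IH[OF rangeI] dest: sym)
  qed
qed

definition opt_mult :: "'u game multiset rel" where
  "opt_mult = mult opt_rel"

lemma wf_opt_mult: "wf opt_mult"
  unfolding opt_mult_def by (rule wf_mult[OF wf_opt_rel])

lemma opt_mult_add1:
  assumes "z \<in> left_opts x \<or> z \<in> right_opts x"
  shows "(add_mset z M, add_mset x M) \<in> opt_mult"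
proof -
  have "(M + {#z#}, M + {#x#}) \<in> mult opt_rel"
    by (rule one_step_implies_mult) (use assms in \<open>auto simp: opt_rel_def\<close>)
  then show ?thesis by (simp add: opt_mult_def)
qed

function le_game :: "'u game \<Rightarrow> 'u game \<Rightarrow> bool" where
  "le_game x y \<longleftrightarrow>
     (\<forall>xl \<in> left_opts x. \<not> le_game y xl) \<and> (\<forall>yr \<in> right_opts y. \<not> le_game yr x)"
  by pat_completeness auto
termination
proof (relation "inv_image opt_mult (\<lambda>(x, y). {#x, y#})")
  show "wf (inv_image opt_mult (\<lambda>(x :: 'a game, y). {#x, y#}))"
    by (rule wf_inv_image[OF wf_opt_mult])
next
  fix x y xl :: "'a game" assume "xl \<in> left_opts x"
  then show "((y, xl), x, y) \<in> inv_image opt_mult (\<lambda>(x, y). {#x, y#})"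
    using opt_mult_add1[of xl x "{#y#}"] by (simp add: add_mset_commute)
next
  fix x y yr :: "'a game" assume "yr \<in> right_opts y"
  then show "((yr, x), x, y) \<in> inv_image opt_mult (\<lambda>(x, y). {#x, y#})"
    using opt_mult_add1[of yr y "{#x#}"] by (simp add: add_mset_commute)
qed

declare le_game.simps [simp del]

inductive is_number :: "'u game \<Rightarrow> bool" where
  "\<lbrakk>is_small (dom l); is_small (dom r);
    \<And>x. x \<in> ran l \<Longrightarrow> is_number x; \<And>x. x \<in> ran r \<Longrightarrow> is_number x;
    \<And>x y. x \<in> ran l \<Longrightarrow> y \<in> ran r \<Longrightarrow> \<not> le_game y x\<rbrakk> \<Longrightarrow> is_number (Game l r)"

lemma le_game_refl: "le_game x x"
proof (induction x rule: wf_induct_rule[OF wf_opt_rel])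
  case (1 x)
  have "\<not> le_game x xl" if "xl \<in> left_opts x" for xl
  proof -
    have "le_game xl xl" using 1 that by (auto simp: opt_rel_def)
    then show ?thesis using that le_game.simps[of x xl] by blast
  qed
  moreover have "\<not> le_game xr x" if "xr \<in> right_opts x" for xr
  proof -
    have "le_game xr xr" using 1 that by (auto simp: opt_rel_def)
    then show ?thesis using that le_game.simps[of xr x] by blast
  qed
  ultimately show ?case by (subst le_game.simps) blast
qed

lemma le_game_trans:
  assumes "le_game x y" "le_game y z" shows "le_game x z"
proof -
  have "\<forall>x y z. M = {#x, y, z#} \<longrightarrow> le_game x y \<longrightarrow> le_game y z \<longrightarrow> le_game x z" for M
  proof (induction M rule: wf_induct_rule[OF wf_opt_mult])
    case (1 M)
    show ?case
    proof (intro allI impI)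
      fix x y z assume M: "M = {#x, y, z#}" and xy: "le_game x y" and yz: "le_game y z"
      have "\<not> le_game z xl" if "xl \<in> left_opts x" for xl
      proof
        assume "le_game z xl"
        moreover have "({#y, z, xl#}, M) \<in> opt_mult"
          using opt_mult_add1[of xl x "{#y, z#}"] that by (simp add: M add_mset_commute)
        ultimately have "le_game y xl" using 1 yz by blast
        then show False using xy that le_game.simps[of x y] by blast
      qed
      moreover have "\<not> le_game zr x" if "zr \<in> right_opts z" for zr
      proof
        assume "le_game zr x"
        moreover have "({#zr, x, y#}, M) \<in> opt_mult"
          using opt_mult_add1[of zr z "{#x, y#}"] that by (simp add: M add_mset_commute)
        ultimately have "le_game zr y" using 1 xy by blast
        then show False using yz that le_game.simps[of y z] by blast
      qed
      ultimately show "le_game x z" by (subst le_game.simps) blast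
    qed
  qed
  then show ?thesis using assms by blast
qed

lemma number_opts:
  assumes "is_number x"
  shows "\<forall>xl \<in> left_opts x. le_game xl x" "\<forall>xr \<in> right_opts x. le_game x xr"
  using assms
proof (induction rule: is_number.induct)
  case (1 l r)
  let ?x = "Game l r"
  {
    case 1
    show ?case
    proof
      fix xl assume xl: "xl \<in> left_opts ?x"
      have "\<not> le_game ?x xll" if "xll \<in> left_opts xl" for xll
      proof
        assume "le_game ?x xll"
        moreover have "le_game xll xl" using xl that "1.IH" by auto
        ultimately have "le_game ?x xl" by (rule le_game_trans)
        then show False using xl le_game_refl le_game.simps[of ?x xl] by blast
      qed
      moreover have "\<not> le_game xr xl" if "xr \<in> right_opts ?x" for xr
        using xl that "1.hyps" by auto
      ultimately show "le_game xl ?x" by (subst le_game.simps) blast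
    qed
  next
    case 2
    show ?case
    proof
      fix xr assume xr: "xr \<in> right_opts ?x"
      have "\<not> le_game xrr ?x" if "xrr \<in> right_opts xr" for xrr
      proof
        assume "le_game xrr ?x"
        moreover have "le_game xr xrr" using xr that "1.IH" by auto
        ultimately have "le_game xr ?x" using le_game_trans by blast
        then show False using xr le_game_refl le_game.simps[of xr ?x] by blast
      qed
      moreover have "\<not> le_game xr xl" if "xl \<in> left_opts ?x" for xl
        using xr that "1.hyps" by auto
      ultimately show "le_game ?x xr" by (subst le_game.simps) blast
    qed
  }
qed

lemma le_game_total:
  assumes "is_number x" "is_number y" shows "le_game x y \<or> le_game y x"
proof (rule ccontr)
  assume *: "\<not> ?thesis"
  then consider xl where "xl \<in> left_opts x" "le_game y xl"
    | yr where "yr \<in> right_opts y" "le_game yr x"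
    using le_game.simps[of x y] by blast
  then show False
    using * number_opts[OF assms(1)] number_opts[OF assms(2)] le_game_trans by cases blast+
qed

definition eq_number :: "'u game \<Rightarrow> 'u game \<Rightarrow> bool" where
  "eq_number x y \<longleftrightarrow> is_number x \<and> is_number y \<and> le_game x y \<and> le_game y x"

quotient_type 'u surreal = "('u :: universe) game" / partial: eq_number
proof (rule part_equivpI)
  have "is_small ({} :: 'u set)" by (rule is_small_empty)
  then have "is_number (Game (\<lambda>_. None) (\<lambda>_. None) :: 'u game)"
    by (intro is_number.intros) (auto simp: ran_def)
  then show "\<exists>x :: 'u game. eq_number x x"
    unfolding eq_number_def using le_game_refl by blast
  show "symp (eq_number :: 'u game \<Rightarrow> _)"
    by (auto simp: symp_def eq_number_def)
  show "transp (eq_number :: 'u game \<Rightarrow> _)"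
    by (auto simp: transp_def eq_number_def intro: le_game_trans)
qed

instantiation surreal :: (universe) linorder
begin

lift_definition less_eq_surreal :: "'a surreal \<Rightarrow> 'a surreal \<Rightarrow> bool" is le_game
  by (auto simp: eq_number_def intro: le_game_trans)

definition less_surreal :: "'a surreal \<Rightarrow> 'a surreal \<Rightarrow> bool" where
  "less_surreal x y \<longleftrightarrow> x \<le> y \<and> \<not> y \<le> x"

instance
proof
  fix x y z :: "'a surreal"
  show "x < y \<longleftrightarrow> x \<le> y \<and> \<not> y \<le> x" by (rule less_surreal_def)
  show "x \<le> x" by transfer (rule le_game_refl)
  show "x \<le> y \<Longrightarrow> y \<le> z \<Longrightarrow> x \<le> z" by transfer (rule le_game_trans)
  show "x \<le> y \<Longrightarrow> y \<le> x \<Longrightarrow> x = y" by transfer (simp add: eq_number_def)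
  show "x \<le> y \<or> y \<le> x" by transfer (simp add: eq_number_def le_game_total)
qed

end


section \<open>Open classes and continuity\<close>

text \<open>\<open>Off\<close> and \<open>On\<close> are the gaps below and above all numbers.\<close>

datatype 'u endpoint = Off | Num "('u :: universe) surreal" | On

fun endpoint_less :: "('u :: universe) endpoint \<Rightarrow> 'u endpoint \<Rightarrow> bool" where
  "endpoint_less Off e \<longleftrightarrow> e \<noteq> Off"
| "endpoint_less (Num x) Off \<longleftrightarrow> False"
| "endpoint_less (Num x) (Num y) \<longleftrightarrow> x < y"
| "endpoint_less (Num x) On \<longleftrightarrow> True"
| "endpoint_less On e \<longleftrightarrow> False"

definition open_interval :: "('u :: universe) surreal set \<Rightarrow> bool" where
  "open_interval X \<longleftrightarrow>
     (\<exists>c d. X = {x. endpoint_less c (Num x) \<and> endpoint_less (Num x) d})"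

text \<open>
  Only unions over a \<^emph>\<open>set\<close> of indices are allowed, so the open classes are in general not closed
  under arbitrary unions and do not form a topology in the usual sense.
\<close>

definition open_class :: "('u :: universe) surreal set \<Rightarrow> bool" where
  "open_class A \<longleftrightarrow>
     (\<exists>(I :: 'u set) X. is_small I \<and> (\<forall>i \<in> I. open_interval (X i)) \<and> A = (\<Union>i \<in> I. X i))"

definition open_in_class :: "('u :: universe) surreal set \<Rightarrow> 'u surreal set \<Rightarrow> bool" where
  "open_in_class X X' \<longleftrightarrow> (\<exists>X''. open_class X'' \<and> X' = X \<inter> X'')"

text \<open>
  A function with domain \<open>A\<close> is a total HOL function of which only the values on \<open>A\<close> matter;
  the preimage is accordingly \<open>{x \<in> A. f x \<in> B}\<close>.
\<close>

definition surreal_continuous_on ::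
  "('u :: universe) surreal set \<Rightarrow> ('u surreal \<Rightarrow> 'u surreal) \<Rightarrow> bool" where
  "surreal_continuous_on A f \<longleftrightarrow> (\<forall>B. open_class B \<longrightarrow> open_in_class A {x \<in> A. f x \<in> B})"

end

theory Submission
  imports Defs
begin

text \<open>
  The classes \<open>{x. x < u}\<close> and \<open>{x. u < x}\<close> are open, so if \<open>f\<close> omitted the value \<open>u\<close>, their
  preimages would split \<open>[a, b]\<close> into two disjoint relatively open pieces containing the two
  endpoints.  What has to be shown is thus that \<open>[a, b]\<close> is connected, although \<open>No\<close> is not
  Dedekind complete and its sections have no suprema in general.

  The substitute for completeness is the simplicity construction (\<open>ex_surreal_between_sets\<close>): a
  \<^emph>\<open>set\<close> of numbers lying below another \<^emph>\<open>set\<close> of numbers leaves room for a number strictly in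
  between.  Suppose \<open>[a, b]\<close> is covered by disjoint open pieces \<open>A\<close> and \<open>B\<close> with \<open>a \<in> A\<close> and
  \<open>b \<in> B\<close>, and let \<open>S\<close> be the initial part of \<open>[a, b]\<close> that lies in \<open>A\<close> without interruption.
  Since \<open>A\<close> and \<open>B\<close> are unions of set-many intervals, set-many interval endpoints are cofinal in
  \<open>S\<close>, and set-many are coinitial in its complement; in particular neither side contains its
  boundary point.  A number strictly between those two sets of endpoints lies in \<open>[a, b]\<close> and yet
  on neither side, a contradiction (\<open>surreal_interval_connected\<close>).  This is where it matters that
  open classes are unions of set-many intervals: with arbitrary unions every section without a
  boundary point would disconnect \<open>No\<close>.
\<close>

section \<open>Numbers between sets of numbers\<close>

text \<open>The number obtained is \<open>{X | Y}\<close>.  The sets are mapped injectively into the type \<open>'u\<close>, which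
  supplies the indices of the options of a game.\<close>

lemma ex_surreal_between_sets:
  fixes X Y :: "('u :: universe) surreal set"
  assumes X: "|X| <o |UNIV :: 'u set|" and Y: "|Y| <o |UNIV :: 'u set|"
    and less: "\<And>x y. x \<in> X \<Longrightarrow> y \<in> Y \<Longrightarrow> x < y"
  shows "\<exists>p. (\<forall>x \<in> X. x < p) \<and> (\<forall>y \<in> Y. p < y)"
proof -
  have index: "\<exists>l :: 'u \<Rightarrow> 'u game option. is_small (dom l) \<and> ran l = rep_surreal ` Z"
    if Z: "|Z| <o |UNIV :: 'u set|" for Z :: "'u surreal set"
  proof -
    obtain h :: "'u surreal \<Rightarrow> 'u" where h: "inj_on h Z"
      using ordLess_imp_ordLeq[OF Z] by (auto simp: card_of_ordLeq[symmetric])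
    define l where "l i = (if i \<in> h ` Z then Some (rep_surreal (inv_into Z h i)) else None)" for i
    have "|dom l| \<le>o |Z|"
      using card_of_image[of h Z] by (simp add: l_def dom_def)
    then have "is_small (dom l)"
      unfolding is_small_def using Z by (rule ordLeq_ordLess_trans)
    moreover have "ran l = rep_surreal ` Z"
    proof (rule set_eqI)
      fix x
      have "x \<in> ran l \<longleftrightarrow> (\<exists>i \<in> h ` Z. rep_surreal (inv_into Z h i) = x)"
        by (auto simp: ran_def l_def)
      also have "\<dots> \<longleftrightarrow> x \<in> rep_surreal ` Z"
        using h by auto
      finally show "x \<in> ran l \<longleftrightarrow> x \<in> rep_surreal ` Z" .
    qed
    ultimately show ?thesis by (intro exI[of _ l] conjI)
  qed
  obtain l :: "'u \<Rightarrow> 'u game option" where l: "is_small (dom l)" "ran l = rep_surreal ` X"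
    using index[OF X] by (elim exE conjE)
  obtain r :: "'u \<Rightarrow> 'u game option" where r: "is_small (dom r)" "ran r = rep_surreal ` Y"
    using index[OF Y] by (elim exE conjE)
  have num: "is_number (rep_surreal z)" for z :: "'u surreal"
    using Quotient3_rep_reflp[OF Quotient3_surreal] by (auto simp: eq_number_def)
  have le_rep: "z \<le> w \<longleftrightarrow> le_game (rep_surreal z) (rep_surreal w)" for z w :: "'u surreal"
    by (simp add: less_eq_surreal_def)
  let ?g = "Game l r"
  have "\<not> le_game z w" if wz: "w \<in> ran l" "z \<in> ran r" for w z
  proof -
    obtain x y where "x \<in> X" "w = rep_surreal x" "y \<in> Y" "z = rep_surreal y"
      using wz unfolding l(2) r(2) by (elim imageE)
    moreover from this have "\<not> y \<le> x" using less[of x y] by (simp add: not_le)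
    ultimately show ?thesis using le_rep[of y x] by simp
  qed
  then have g: "is_number ?g"
    using l r num by (intro is_number.intros) auto
  define p where "p = abs_surreal ?g"
  have "eq_number ?g (rep_surreal p)"
    unfolding p_def using g
    by (intro rep_abs_rsp[OF Quotient3_surreal]) (simp add: eq_number_def le_game_refl)
  then have gp: "le_game ?g (rep_surreal p)" "le_game (rep_surreal p) ?g"
    by (auto simp: eq_number_def)
  have "x < p" if "x \<in> X" for x
  proof -
    have "\<not> le_game ?g (rep_surreal x)"
      using le_game_refl[of ?g] le_game.simps[of ?g ?g] l(2) that by simp
    then have "\<not> p \<le> x"
      using le_game_trans[OF gp(1)] le_rep by blast
    then show ?thesis by simp
  qed
  moreover have "p < y" if "y \<in> Y" for y
  proof -
    have "\<not> le_game (rep_surreal y) ?g"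
      using le_game_refl[of ?g] le_game.simps[of ?g ?g] r(2) that by simp
    then have "\<not> y \<le> p"
      using le_game_trans[OF _ gp(2)] le_rep by blast
    then show ?thesis by simp
  qed
  ultimately show ?thesis by blast
qed

lemma finite_card_of_ordLess_universe:
  assumes "finite F"
  shows "|F| <o |UNIV :: ('u :: universe) set|"
proof -
  have "infinite (UNIV :: 'u set)"
    using universe_infinity ordLess_imp_ordLeq infinite_iff_card_of_nat by blast
  then show ?thesis
    using assms by (intro finite_ordLess_infinite card_of_Well_order) (simp_all add: Field_card_of)
qed

text \<open>Density of \<open>No\<close>, in the form that says that an interval of numbers with \<open>y\<close> in its interior
  also contains numbers below \<open>y\<close> that are as close to \<open>y\<close> as any given \<open>x\<close>.\<close>

lemma ex_surreal_between_after_endpoint: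
  fixes x y :: "('u :: universe) surreal"
  assumes "x < y" and "endpoint_less c (Num y)"
  shows "\<exists>t. x < t \<and> t < y \<and> endpoint_less c (Num t)"
proof -
  let ?X = "insert x {s. c = Num s}"
  have "finite {s. c = Num s}" by (cases c) auto
  then have "\<exists>t. (\<forall>s \<in> ?X. s < t) \<and> (\<forall>s \<in> {y}. t < s)"
    using assms by (intro ex_surreal_between_sets finite_card_of_ordLess_universe) auto
  then show ?thesis using assms(2) by (cases c) auto
qed

section \<open>Open classes\<close>

lemma open_classE:
  fixes A :: "('u :: universe) surreal set"
  assumes "open_class A"
  obtains I :: "'u set" and c d where "is_small I"
    and "A = (\<Union>i \<in> I. {x. endpoint_less (c i) (Num x) \<and> endpoint_less (Num x) (d i)})"
proof -
  obtain I :: "'u set" and X where I: "is_small I" "\<forall>i \<in> I. open_interval (X i)"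
    and A: "A = (\<Union>i \<in> I. X i)"
    using assms unfolding open_class_def by blast
  obtain c d where
    "\<forall>i \<in> I. X i = {x. endpoint_less (c i) (Num x) \<and> endpoint_less (Num x) (d i)}"
    using I(2) unfolding open_interval_def by metis
  with A have "A = (\<Union>i \<in> I. {x. endpoint_less (c i) (Num x) \<and> endpoint_less (Num x) (d i)})"
    by simp
  with I(1) show ?thesis by (rule that)
qed

lemma open_interval_imp_open_class:
  fixes X :: "('u :: universe) surreal set"
  assumes "open_interval X"
  shows "open_class X"
proof -
  have "is_small {undefined :: 'u}"
    unfolding is_small_def by (rule finite_card_of_ordLess_universe) simp
  then show ?thesis
    unfolding open_class_def using assms
    by (intro exI[of _ "{undefined :: 'u}"] exI[of _ "\<lambda>_. X"]) simp
qed

lemma open_class_lessThan: "open_class {..<u}"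
proof (rule open_interval_imp_open_class)
  show "open_interval {..<u}"
    unfolding open_interval_def by (rule exI[of _ Off], rule exI[of _ "Num u"]) auto
qed

lemma open_class_greaterThan: "open_class {u<..}"
proof (rule open_interval_imp_open_class)
  show "open_interval {u<..}"
    unfolding open_interval_def by (rule exI[of _ "Num u"], rule exI[of _ On]) auto
qed

lemma endpoint_less_Num_trans:
  "endpoint_less c (Num x) \<Longrightarrow> x \<le> y \<Longrightarrow> endpoint_less c (Num y)"
  "endpoint_less (Num y) d \<Longrightarrow> x \<le> y \<Longrightarrow> endpoint_less (Num x) d"
  by (cases c; auto) (cases d; auto)

lemma small_number_endpoints:
  fixes e :: "'u \<Rightarrow> ('u :: universe) endpoint"
  assumes "is_small I"
  shows "|{s \<in> S. Num s \<in> e ` I}| <o |UNIV :: 'u set|"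
proof -
  have "{s \<in> S. Num s \<in> e ` I} \<subseteq> (\<lambda>i. SOME s. e i = Num s) ` I"
  proof
    fix s assume "s \<in> {s \<in> S. Num s \<in> e ` I}"
    then obtain i where "i \<in> I" "e i = Num s" by force
    then show "s \<in> (\<lambda>i. SOME s. e i = Num s) ` I" by (intro image_eqI[of _ _ i]) auto
  qed
  then have "|{s \<in> S. Num s \<in> e ` I}| \<le>o |I|"
    by (rule ordLeq_transitive[OF card_of_mono1 card_of_image])
  then show ?thesis
    using assms unfolding is_small_def by (rule ordLeq_ordLess_trans)
qed

section \<open>Connectedness and intermediate values\<close>

text \<open>
  In the proof, \<open>S\<close> is the initial part of \<open>[a, b]\<close> reached inside \<open>A\<close>, and \<open>T\<close> is the rest.
  The sets \<open>L\<close> and \<open>R\<close> of endpoints make the section \<open>(S, T)\<close> accessible to the set-sized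
  interpolation.  The claim \<open>cofinal\<close> excludes that \<open>S\<close> is cut off by an endpoint outside it: such
  an endpoint would belong to \<open>B\<close>, and points of \<open>S\<close> just below it would belong to \<open>B\<close> as well.
  The claim \<open>coinitial\<close> needs it: the lower endpoint of an interval of \<open>B\<close> that meets \<open>[a, b]\<close>
  is an upper bound of \<open>S\<close>, hence outside \<open>S\<close> because \<open>S\<close> has no greatest element.
\<close>

lemma surreal_interval_connected:
  fixes a b :: "('u :: universe) surreal"
  assumes ab: "a \<le> b" and A: "open_class A" and B: "open_class B"
    and cover: "{a..b} \<subseteq> A \<union> B" and disj: "{a..b} \<inter> A \<inter> B = {}"
    and aA: "a \<in> A"
  shows "b \<in> A"
proof (rule ccontr)
  assume bA: "b \<notin> A"
  obtain I :: "'u set" and c d where I: "is_small I"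
    and A_eq: "A = (\<Union>i \<in> I. {x. endpoint_less (c i) (Num x) \<and> endpoint_less (Num x) (d i)})"
    by (rule open_classE[OF A])
  obtain J :: "'u set" and c' d' where J: "is_small J"
    and B_eq: "B = (\<Union>j \<in> J. {x. endpoint_less (c' j) (Num x) \<and> endpoint_less (Num x) (d' j)})"
    by (rule open_classE[OF B])
  define S where "S = {x. a \<le> x \<and> x \<le> b \<and> {a..x} \<subseteq> A}"
  define T where "T = {a..b} - S"
  define L where "L = {s \<in> S. Num s \<in> d ` I}"
  define R where "R = {s \<in> T. Num s \<in> c' ` J}"
  have aS: "a \<in> S" using ab aA by (auto simp: S_def)
  have bT: "b \<in> T" using ab bA by (auto simp: S_def T_def)
  have S_D: "a \<le> s" "s \<le> b" "s \<in> A" if "s \<in> S" for s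
    using that by (auto simp: S_def subset_iff)
  have S_less_T: "s < t" if "s \<in> S" "t \<in> T" for s t
  proof (rule ccontr)
    assume "\<not> s < t"
    then have "{a..t} \<subseteq> {a..s}" by (simp add: not_less)
    also have "\<dots> \<subseteq> A" using that by (simp add: S_def)
    finally have "t \<in> S" using that by (simp add: S_def T_def)
    then show False using that by (simp add: T_def)
  qed

  have cofinal: "\<exists>l \<in> L. x < l" if x: "x \<in> S" for x
  proof -
    have "x \<in> A" using x by (auto simp: S_def)
    then obtain i where i: "i \<in> I" "endpoint_less (c i) (Num x)" "endpoint_less (Num x) (d i)"
      using A_eq by blast
    \<comment> \<open>The interval around \<open>x\<close> ends before \<open>b\<close>, since otherwise it would contain \<open>b\<close>.\<close>
    have extend: "t \<in> A" if "x \<le> t" "endpoint_less (Num t) (d i)" for t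
      using i that endpoint_less_Num_trans(1) A_eq by blast
    have "\<not> endpoint_less (Num b) (d i)"
      using extend x bA by (auto simp: S_def)
    then obtain s where s: "d i = Num s" "x < s" "s \<le> b"
      using i(3) by (cases "d i") auto
    have "s \<in> S"
    proof (rule ccontr)
      assume "s \<notin> S"
      have below: "t \<in> A" if "a \<le> t" "t < s" for t
        using that x extend[of t] s(1) by (cases "t \<le> x") (auto simp: S_def)
      have "a \<le> s" using x s by (auto simp: S_def)
      have "s \<notin> A"
      proof
        assume "s \<in> A"
        with below have "{a..s} \<subseteq> A" by (force simp: le_less)
        then show False using \<open>s \<notin> S\<close> \<open>a \<le> s\<close> s by (simp add: S_def)
      qed
      then have "s \<in> B" using cover \<open>a \<le> s\<close> s by auto
      then obtain j where j: "j \<in> J" "endpoint_less (c' j) (Num s)" "endpoint_less (Num s) (d' j)"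
        using B_eq by blast
      obtain t where t: "x < t" "t < s" "endpoint_less (c' j) (Num t)"
        using ex_surreal_between_after_endpoint[OF s(2) j(2)] by blast
      have "t \<in> B" using B_eq j t endpoint_less_Num_trans(2)[of s "d' j" t] by auto
      moreover have "a \<le> t" "t \<le> b" using t x s by (auto simp: S_def)
      ultimately show False using below t(2) disj by auto
    qed
    moreover have "Num s \<in> d ` I" using s(1) i(1) by (metis imageI)
    ultimately show ?thesis using s(2) by (auto simp: L_def)
  qed

  have coinitial: "\<exists>r \<in> R. r < y" if y: "y \<in> T" for y
  proof -
    have "\<not> {a..y} \<subseteq> A"
      using y by (simp add: T_def S_def)
    then obtain z where z: "a \<le> z" "z \<le> y" "z \<notin> A"
      by (meson atLeastAtMost_iff subsetI)
    have yb: "y \<le> b" using y by (simp add: T_def)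
    with z have zb: "z \<le> b" by (meson order_trans)
    then have "z \<in> B" using cover z by (simp add: subset_iff) blast
    then obtain j where j: "j \<in> J" "endpoint_less (c' j) (Num z)" "endpoint_less (Num z) (d' j)"
      using B_eq by blast
    have S_bound: "\<not> endpoint_less (c' j) (Num s)" if s: "s \<in> S" for s
    proof
      assume "endpoint_less (c' j) (Num s)"
      moreover have "s \<le> z" using s z by (force simp: S_def)
      ultimately have "s \<in> B" using B_eq j endpoint_less_Num_trans(2)[of z "d' j" s] by auto
      then show False using S_D[OF s] disj by auto
    qed
    obtain r where r: "c' j = Num r" "r < z"
      using S_bound[OF aS] j(2) by (cases "c' j") auto
    \<comment> \<open>The lower end \<open>r\<close> of an interval of \<open>B\<close> around \<open>z\<close> separates that interval from \<open>S\<close>.\<close>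
    have r_ge: "s \<le> r" if "s \<in> S" for s
      using S_bound[OF that] r by simp
    have "r \<notin> S"
    proof
      assume "r \<in> S"
      then obtain l where "l \<in> L" "r < l" using cofinal by blast
      moreover from this have "l \<le> r" using r_ge by (simp add: L_def)
      ultimately show False by order
    qed
    moreover have "a \<le> r" using r_ge[OF aS] .
    moreover have "r \<le> b" using r(2) zb by order
    ultimately have "r \<in> T" by (simp add: T_def)
    moreover have "Num r \<in> c' ` J" using r(1) j(1) by (metis imageI)
    moreover have "r < y" using r(2) z(2) by order
    ultimately show ?thesis by (auto simp: R_def)
  qed

  have "|L| <o |UNIV :: 'u set|" "|R| <o |UNIV :: 'u set|"
    unfolding L_def R_def using I J by (auto intro: small_number_endpoints)
  then obtain p where p: "\<forall>l \<in> L. l < p" "\<forall>r \<in> R. p < r"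
    using ex_surreal_between_sets[of L R] S_less_T by (auto simp: L_def R_def)
  have S_less_p: "s < p" if "s \<in> S" for s
    using cofinal[OF that] p(1) less_trans by blast
  have p_less_T: "p < t" if "t \<in> T" for t
    using coinitial[OF that] p(2) less_trans by blast
  have "a \<le> p" "p \<le> b"
    using S_less_p[OF aS] p_less_T[OF bT] by simp_all
  then have "p \<in> S \<or> p \<in> T" by (simp add: T_def)
  then show False using S_less_p p_less_T by blast
qed

theorem theorem37:
  fixes f :: "('u :: universe) surreal \<Rightarrow> 'u surreal" and a b u :: "'u surreal"
  assumes "a \<le> b"
    and "surreal_continuous_on {a..b} f"
    and "f a \<le> u \<and> u \<le> f b \<or> f b \<le> u \<and> u \<le> f a"
  shows "\<exists>p \<in> {a..b}. f p = u"
proof (rule ccontr)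
  assume none: "\<not> ?thesis"
  have preimage: "\<exists>X. open_class X \<and> (\<forall>x \<in> {a..b}. x \<in> X \<longleftrightarrow> f x \<in> V)"
    if V: "open_class V" for V
  proof -
    have "open_in_class {a..b} {x \<in> {a..b}. f x \<in> V}"
      using assms(2) V by (simp add: surreal_continuous_on_def)
    then obtain X where X: "open_class X" and eq: "{x \<in> {a..b}. f x \<in> V} = {a..b} \<inter> X"
      unfolding open_in_class_def by (elim exE conjE)
    have "x \<in> X \<longleftrightarrow> f x \<in> V" if "x \<in> {a..b}" for x
    proof -
      have "x \<in> {x \<in> {a..b}. f x \<in> V} \<longleftrightarrow> x \<in> {a..b} \<inter> X" by (simp only: eq)
      then show ?thesis using that by simp
    qed
    with X show ?thesis by (intro exI[of _ X] conjI ballI)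
  qed
  obtain A where A: "open_class A" "\<forall>x \<in> {a..b}. x \<in> A \<longleftrightarrow> f x \<in> {..<u}"
    using preimage[OF open_class_lessThan[of u]] by (elim exE conjE)
  obtain B where B: "open_class B" "\<forall>x \<in> {a..b}. x \<in> B \<longleftrightarrow> f x \<in> {u<..}"
    using preimage[OF open_class_greaterThan[of u]] by (elim exE conjE)
  have inA: "x \<in> A \<longleftrightarrow> f x < u" and inB: "x \<in> B \<longleftrightarrow> u < f x" if "x \<in> {a..b}" for x
    using A(2)[rule_format, OF that] B(2)[rule_format, OF that] by simp_all
  have cover: "{a..b} \<subseteq> A \<union> B"
  proof
    fix x assume x: "x \<in> {a..b}"
    then have "f x \<noteq> u" using none by blast
    then show "x \<in> A \<union> B" using inA[OF x] inB[OF x] by (simp add: neq_iff)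
  qed
  have disj: "{a..b} \<inter> A \<inter> B = {}"
  proof -
    have "x \<notin> A \<or> x \<notin> B" if "x \<in> {a..b}" for x
      using inA[OF that] inB[OF that] less_asym by blast
    then show ?thesis by blast
  qed
  have ends: "a \<in> {a..b}" "b \<in> {a..b}" "f a \<noteq> u" "f b \<noteq> u"
    using assms(1) none by auto
  have "a \<in> A \<Longrightarrow> b \<in> A"
    using surreal_interval_connected[OF assms(1) A(1) B(1) cover disj] .
  moreover have "a \<in> B \<Longrightarrow> b \<in> B"
    using surreal_interval_connected[OF assms(1) B(1) A(1)] cover disj
    by (simp add: Un_commute Int_ac)
  moreover have "f a < u \<and> u < f b \<or> f b < u \<and> u < f a"
    using assms(3) ends(3,4) by (simp add: less_le)
  ultimately show False
    using inA[OF ends(1)] inA[OF ends(2)] inB[OF ends(1)] inB[OF ends(2)] less_asym by blast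
qed

end
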